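(* Let $G_1,G_2$ be positive integers and let $(G_n)_{n\geq1}$ be the Gibonacci sequence defined by $G_n=G_{n-1}+G_{n-2}$ for $n\geq3$. Define $a_0^{\{G_1,G_2\}}(m)=G_m$ for $m\geq1$, and for $k\geq1$ define $a_k^{\{G_1,G_2\}}(m)=\sum_{i=1}^{m}a_{k-1}^{\{G_1,G_2\}}(i)$ for $m\geq1$; set $a_k^{\{G_1,G_2\}}(m)=0$ for $m\leq0$. For integers $n\geq1$ and $k\geq0$ define \[s_k^{\{G_1,G_2\}}(n)=\sum_{\ell\geq k}\left(\binom{n-\ell}{\ell}G_2+\binom{n-\ell}{\ell-1}G_1\right).\] Then for all $k\geq0$ and $n\geq1$, \[s_k^{\{G_1,G_2\}}(n)=a_k^{\{G_1,G_2\}}\big(n-2(k-1)\big).\]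
   Context: Binomial coefficient convention: for integers $m,j$, $\binom{m}{j}$ is the number of $j$-element subsets of an $m$-element set when $m,j\geq0$ (so it is $0$ if $j>m$), and $\binom{m}{j}=0$ if $j<0$ or $m<0$. Combinatorially, $s_k^{\{G_1,G_2\}}(n)$ counts colored Schreier sets: subsets $S\subseteq\{1,\dots,n\}$ with $|S|\geq k$ and $\min S\geq|S|$, where if $\min S=|S|$ the element $|S|$ carries one of $G_1$ colors, and if $\min S>|S|$ one distinguished element carries one of $G_2$ colors. *)

theory Defs
  imports Complex_Main "HOL-Analysis.Infinite_Sum"
begin

(* Index 0 is not part of the sequence; its value is a placeholder. *)
fun gibonacci :: "int \<Rightarrow> int \<Rightarrow> nat \<Rightarrow> int" where
  "gibonacci G1 G2 0 = 0"
| "gibonacci G1 G2 (Suc 0) = G1"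
| "gibonacci G1 G2 (Suc (Suc 0)) = G2"
| "gibonacci G1 G2 (Suc (Suc (Suc n))) = gibonacci G1 G2 (Suc (Suc n)) + gibonacci G1 G2 (Suc n)"

primrec iter_partial_sum :: "int \<Rightarrow> int \<Rightarrow> nat \<Rightarrow> int \<Rightarrow> int" where
  "iter_partial_sum G1 G2 0 m = (if m \<ge> 1 then gibonacci G1 G2 (nat m) else 0)"
| "iter_partial_sum G1 G2 (Suc k) m =
     (if m \<ge> 1 then (\<Sum>i = 1..m. iter_partial_sum G1 G2 k i) else 0)"

(* Unlike gchoose, this vanishes for a negative upper argument. *)
definition int_binomial :: "int \<Rightarrow> int \<Rightarrow> int" where
  "int_binomial m j = (if m < 0 \<or> j < 0 then 0 else int (nat m choose nat j))"

(* Only finitely many terms are nonzero, so infsum (over the discrete type int) is the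
   ordinary sum of these terms; see schreier_sum_finite. *)
definition schreier_sum :: "int \<Rightarrow> int \<Rightarrow> nat \<Rightarrow> int \<Rightarrow> int" where
  "schreier_sum G1 G2 k n =
     (\<Sum>\<^sub>\<infinity>l\<in>{k..}. int_binomial (n - int l) (int l) * G2
                + int_binomial (n - int l) (int l - 1) * G1)"

lemma schreier_sum_finite:
  assumes "n \<ge> 0"
  shows "schreier_sum G1 G2 k n =
    (\<Sum>l = k..nat n. int_binomial (n - int l) (int l) * G2
                 + int_binomial (n - int l) (int l - 1) * G1)"
proof -
  let ?t = "\<lambda>l. int_binomial (n - int l) (int l) * G2 + int_binomial (n - int l) (int l - 1) * G1"
  have "infsum ?t {k..} = infsum ?t {k..nat n}"
    using assms by (intro infsum_cong_neutral) (auto simp: int_binomial_def)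
  then show ?thesis by (simp add: schreier_sum_def)
qed

end

(* Pascal's rule turns the summands t(n,l) into t(n,l+1) = t(n-1,l+1) + t(n-2,l) for n other
   than 1.  Summing over l gives s_{k+1}(n) = s_{k+1}(n-1) + s_k(n-2), which is the recurrence
   a_{k+1}(m) = a_{k+1}(m-1) + a_k(m) at m = n - 2k.  The l = 0 summand is G2 for every n >= 0, so
   s_0 satisfies the Fibonacci recurrence.  Both sides agree for n = 0 and n = 1. *)
theory Submission
  imports Defs
begin

text \<open>Outside \<open>m, j \<ge> 1\<close> the zero convention decides both sides. At
  \<open>m = j = 0\<close> the left side is 1 and the right side 0, hence the assumption.\<close>

lemma int_binomial_pascal:
  assumes "m \<noteq> 0 \<or> j \<noteq> 0"
  shows "int_binomial m j = int_binomial (m - 1) j + int_binomial (m - 1) (j - 1)"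
proof (cases "m \<ge> 1 \<and> j \<ge> 1")
  case True
  then have "nat m = Suc (nat (m - 1))" "nat j = Suc (nat (j - 1))"
    by auto
  then have "nat m choose nat j = (nat (m - 1) choose nat j) + (nat (m - 1) choose nat (j - 1))"
    by (simp only: binomial_Suc_Suc add.commute)
  with True show ?thesis
    by (simp add: int_binomial_def)
next
  case False
  with assms show ?thesis
    by (auto simp: int_binomial_def not_le)
qed

definition schreier_term :: "int \<Rightarrow> int \<Rightarrow> int \<Rightarrow> nat \<Rightarrow> int" where
  "schreier_term G1 G2 n l =
     int_binomial (n - int l) (int l) * G2 + int_binomial (n - int l) (int l - 1) * G1"

lemma schreier_term_Suc:
  assumes "n \<noteq> 1"
  shows "schreier_term G1 G2 n (Suc l) =
    schreier_term G1 G2 (n - 1) (Suc l) + schreier_term G1 G2 (n - 2) l"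
proof -
  have "int_binomial (n - int (Suc l)) (int (Suc l)) =
      int_binomial (n - 1 - int (Suc l)) (int (Suc l)) + int_binomial (n - 2 - int l) (int l)"
    using int_binomial_pascal[of "n - int (Suc l)" "int (Suc l)"] by (simp add: algebra_simps)
  \<comment> \<open>Both arguments vanish only for \<open>l = 0\<close> and \<open>n = 1\<close>,
    the value that the assumption excludes.\<close>
  moreover have "int_binomial (n - int (Suc l)) (int l) =
      int_binomial (n - 1 - int (Suc l)) (int l) + int_binomial (n - 2 - int l) (int l - 1)"
    using int_binomial_pascal[of "n - int (Suc l)" "int l"] assms by (auto simp: algebra_simps)
  ultimately show ?thesis
    by (simp add: schreier_term_def algebra_simps)
qed

text \<open>Summands with \<open>l > n\<close> vanish because \<open>n - int l < 0\<close>. The free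
  bound \<open>N\<close> lets the sums for \<open>n\<close>, \<open>n - 1\<close> and
  \<open>n - 2\<close> be compared over matching ranges.\<close>

lemma schreier_sum_eq_sum:
  assumes "n \<ge> 0" "nat n \<le> N"
  shows "schreier_sum G1 G2 k n = sum (schreier_term G1 G2 n) {k..N}"
proof -
  have "schreier_sum G1 G2 k n = sum (schreier_term G1 G2 n) {k..nat n}"
    using assms by (simp add: schreier_sum_finite schreier_term_def)
  also have "\<dots> = sum (schreier_term G1 G2 n) {k..N}"
    using assms by (intro sum.mono_neutral_left) (auto simp: schreier_term_def int_binomial_def)
  finally show ?thesis .
qed

lemma schreier_sum_Suc:
  assumes "n \<ge> 2"
  shows "schreier_sum G1 G2 (Suc k) n =
    schreier_sum G1 G2 (Suc k) (n - 1) + schreier_sum G1 G2 k (n - 2)"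
proof -
  let ?N = "nat n"
  \<comment> \<open>The sum is first extended to \<open>Suc ?N\<close>, so that the index shift ends
    in the range \<open>{k..?N}\<close>.\<close>
  have "schreier_sum G1 G2 (Suc k) n = (\<Sum>l = k..?N. schreier_term G1 G2 n (Suc l))"
    using assms by (simp add: schreier_sum_eq_sum[of _ "Suc ?N"] sum.shift_bounds_cl_Suc_ivl
        del: sum.cl_ivl_Suc)
  also have "\<dots> = (\<Sum>l = k..?N. schreier_term G1 G2 (n - 1) (Suc l)) +
      (\<Sum>l = k..?N. schreier_term G1 G2 (n - 2) l)"
    using assms by (simp add: schreier_term_Suc sum.distrib)
  also have "\<dots> = schreier_sum G1 G2 (Suc k) (n - 1) + schreier_sum G1 G2 k (n - 2)"
    using assms by (simp add: schreier_sum_eq_sum[of "n - 1" "Suc ?N"]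
        schreier_sum_eq_sum[of "n - 2" ?N] sum.shift_bounds_cl_Suc_ivl del: sum.cl_ivl_Suc)
  finally show ?thesis .
qed

lemma schreier_sum_0:
  assumes "n \<ge> 0"
  shows "schreier_sum G1 G2 0 n = G2 + schreier_sum G1 G2 (Suc 0) n"
proof -
  have "schreier_term G1 G2 n 0 = G2"
    using assms by (simp add: schreier_term_def int_binomial_def)
  with assms show ?thesis
    by (simp add: schreier_sum_eq_sum[of _ "nat n"] sum.atLeast_Suc_atMost)
qed

lemma iter_partial_sum_nonpos: "m \<le> 0 \<Longrightarrow> iter_partial_sum G1 G2 k m = 0"
  by (cases k) auto

text \<open>For \<open>m \<le> 0\<close> all three terms vanish, so the rule covers every integer
  \<open>m\<close> and the induction on \<open>n\<close> can use it whatever the sign of the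
  argument.\<close>

lemma iter_partial_sum_Suc:
  "iter_partial_sum G1 G2 (Suc k) m =
    iter_partial_sum G1 G2 (Suc k) (m - 1) + iter_partial_sum G1 G2 k m"
proof (cases "m \<ge> 1")
  case True
  then have "{1..m} = insert m {1..m - 1}"
    by auto
  with True show ?thesis
    by simp
qed (simp add: iter_partial_sum_nonpos)

lemma iter_partial_sum_1: "iter_partial_sum G1 G2 k 1 = G1"
  by (induction k) simp_all

lemma iter_partial_sum_0_rec:
  assumes "m \<ge> 3"
  shows "iter_partial_sum G1 G2 0 m =
    iter_partial_sum G1 G2 0 (m - 1) + iter_partial_sum G1 G2 0 (m - 2)"
proof -
  define j where "j = nat (m - 3)"
  have "nat m = Suc (Suc (Suc j))" "nat (m - 1) = Suc (Suc j)" "nat (m - 2) = Suc j"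
    using assms by (auto simp: j_def)
  with assms show ?thesis
    by simp
qed

text \<open>First base case of the two-step recurrence. For \<open>k = 0\<close> the argument on the
  right is 2 and both sides are \<open>G2\<close>; for \<open>k > 0\<close> the sum is empty and the
  argument is at most 0.\<close>

lemma schreier_sum_at_0:
  "schreier_sum G1 G2 k 0 = iter_partial_sum G1 G2 k (0 - 2 * (int k - 1))"
proof (cases k)
  case 0
  then show ?thesis
    by (simp add: schreier_sum_finite int_binomial_def numeral_2_eq_2)
next
  case (Suc k')
  then show ?thesis
    by (simp add: schreier_sum_finite iter_partial_sum_nonpos del: iter_partial_sum.simps)
qed

text \<open>The argument on the right is 3 for \<open>k = 0\<close>, 1 for \<open>k = 1\<close> and
  negative beyond; the common values are \<open>G1 + G2\<close>, \<open>G1\<close> and 0.\<close>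

lemma schreier_sum_at_1:
  "schreier_sum G1 G2 k 1 = iter_partial_sum G1 G2 k (1 - 2 * (int k - 1))"
proof -
  consider "k = 0" | "k = 1" | "k \<ge> 2"
    by linarith
  then show ?thesis
  proof cases
    case 1
    then show ?thesis
      by (simp add: schreier_sum_finite int_binomial_def numeral_3_eq_3)
  next
    case 2
    then show ?thesis
      using iter_partial_sum_1[of G1 G2 1]
      by (simp add: schreier_sum_finite int_binomial_def)
  next
    case 3
    then show ?thesis
      by (simp add: schreier_sum_finite iter_partial_sum_nonpos)
  qed
qed

text \<open>Strong induction with \<open>k\<close> arbitrary, since the step for
  \<open>Suc k'\<close> uses the hypothesis at \<open>k'\<close>.\<close>

lemma schreier_sum_eq_iter_partial_sum:
  "schreier_sum G1 G2 k (int n) = iter_partial_sum G1 G2 k (int n - 2 * (int k - 1))"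
proof (induction n arbitrary: k rule: less_induct)
  case (less n)
  consider "n = 0" | "n = 1" | "n \<ge> 2"
    by linarith
  then show ?case
  proof cases
    case 1
    then show ?thesis
      using schreier_sum_at_0[of G1 G2 k] by simp
  next
    case 2
    then show ?thesis
      using schreier_sum_at_1[of G1 G2 k] by simp
  next
    case 3
    have IH1: "schreier_sum G1 G2 j (int n - 1) =
        iter_partial_sum G1 G2 j (int n - 1 - 2 * (int j - 1))" for j
      using less.IH[of "n - 1" j] 3 by simp
    have IH2: "schreier_sum G1 G2 j (int n - 2) =
        iter_partial_sum G1 G2 j (int n - 2 - 2 * (int j - 1))" for j
      using less.IH[of "n - 2" j] 3 by simp
    show ?thesis
    proof (cases k)
      case 0
      \<comment> \<open>Splitting off \<open>G2\<close> at both \<open>n\<close> and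
        \<open>n - 1\<close> reduces this to the recurrence for \<open>Suc 0\<close>.\<close>
      have "schreier_sum G1 G2 0 (int n) =
          schreier_sum G1 G2 0 (int n - 1) + schreier_sum G1 G2 0 (int n - 2)"
        using 3 schreier_sum_Suc[of "int n" G1 G2 0] by (simp add: schreier_sum_0[of "int n"]
            schreier_sum_0[of "int n - 1"])
      also have "\<dots> = iter_partial_sum G1 G2 0 (int n + 2)"
        using 3 iter_partial_sum_0_rec[of "int n + 2" G1 G2]
        by (simp add: IH1 IH2 algebra_simps del: iter_partial_sum.simps)
      finally show ?thesis
        using 0 by simp
    next
      case (Suc k')
      have "schreier_sum G1 G2 k (int n) =
          schreier_sum G1 G2 k (int n - 1) + schreier_sum G1 G2 k' (int n - 2)"
        using 3 Suc schreier_sum_Suc[of "int n" G1 G2 k'] by simp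
      \<comment> \<open>With \<open>m = int n - 2 * int k'\<close> the hypotheses supply the
        arguments \<open>m - 1\<close> and \<open>m\<close>: lowering \<open>k\<close> by 1 offsets
        lowering \<open>n\<close> by 2.\<close>
      also have "\<dots> = iter_partial_sum G1 G2 k (int n - 2 * (int k - 1))"
        using iter_partial_sum_Suc[of G1 G2 k' "int n - 2 * int k'"]
        by (simp add: IH1 IH2 Suc algebra_simps del: iter_partial_sum.simps)
      finally show ?thesis .
    qed
  qed
qed

theorem theorem3p4:
  fixes G1 G2 n :: int and k :: nat
  assumes "G1 > 0" and "G2 > 0" and "n \<ge> 1"
  shows "schreier_sum G1 G2 k n = iter_partial_sum G1 G2 k (n - 2 * (int k - 1))"
  using schreier_sum_eq_iter_partial_sum[of G1 G2 k "nat n"] assms by simp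

end
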